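(* Let $\kappa$ be a multiplicity function on the Young graph, $M$ a $\kappa$-central probability measure on $\mathrm{Tab}$ with associated $\kappa$-harmonic function $\varphi$, and $(i,j)$ a box. Let $\mathcal P_M(i,j)$ be the $M$-probability of the set of $\tau\in\mathrm{Tab}$ such that $(i,j)\in\bigcup_n\tau^n$. Then $$\mathcal P_M(i,j)=\sum_{\mu\in H'(i,j)}\dim_\kappa\mu\cdot\kappa\big(\mu,\mu\cup\{(i,j)\}\big)\cdot\varphi\big(\mu\cup\{(i,j)\}\big).$$
   Context: Young graph: its vertices are all Young diagrams (including $\varnothing$); $\mu\nearrow\lambda$ means $\lambda$ is obtained from $\mu$ by adding one box; these pairs are the edges. An infinite path is $\tau=(\varnothing\nearrow\tau^1\nearrow\tau^2\nearrow\dots)$ (equivalently an infinite standard Young tableau); $\mathrm{Tab}$ is the set of infinite paths with the projective-limit topology; for a finite path $\sigma=(\varnothing\nearrow\sigma^1\nearrow\dots\nearrow\sigma^n)$, $\mathrm{Cyl}(\sigma)=\{\tau:\tau^m=\sigma^m,\ m\le n\}$. A multiplicity function is a strictly positive function $\kappa$ on edges; $\kappa(\sigma)=\prod_{m=1}^n\kappa(\sigma^{m-1},\sigma^m)$, and $\dim_\kappa\lambda=\sum\kappa(\sigma)$ over finite paths from $\varnothing$ to $\lambda$. A Borel probability measure $M$ on $\mathrm{Tab}$ is $\kappa$-central if there is a function $\varphi$ on Young diagrams with $M(\mathrm{Cyl}(\sigma))=\kappa(\sigma)\varphi(\lambda)$ for every finite path $\sigma$ ending at $\lambda$; $\varphi$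 is the associated $\kappa$-harmonic function. $H'(i,j)$ is the set of finite Young diagrams $\mu$ not containing the box $(i,j)$ (row $i$, column $j$) such that $\mu\cup\{(i,j)\}$ is a Young diagram. *)

theory Defs
  imports "HOL-Probability.Probability"
begin

text \<open>A box is a pair \<open>(row, column)\<close>, both counted from 1.\<close>

type_synonym diagram = "(nat \<times> nat) set"

definition young_diagram :: "diagram \<Rightarrow> bool" where
  "young_diagram D \<longleftrightarrow> finite D \<and> D \<subseteq> {1..} \<times> {1..} \<and>
     (\<forall>i j i' j'. (i, j) \<in> D \<and> 1 \<le> i' \<and> i' \<le> i \<and> 1 \<le> j' \<and> j' \<le> j \<longrightarrow> (i', j') \<in> D)"

definition young_edge :: "diagram \<Rightarrow> diagram \<Rightarrow> bool"  (infix \<open>\<nearrow>\<close> 50) where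
  "D \<nearrow> E \<longleftrightarrow> young_diagram D \<and> young_diagram E \<and> (\<exists>b. b \<notin> D \<and> E = insert b D)"

text \<open>A finite path with \<open>n\<close> edges is the list of its \<open>n + 1\<close> vertices.\<close>

definition fin_path :: "diagram list \<Rightarrow> bool" where
  "fin_path \<sigma> \<longleftrightarrow> \<sigma> \<noteq> [] \<and> \<sigma> ! 0 = {} \<and> (\<forall>m. Suc m < length \<sigma> \<longrightarrow> \<sigma> ! m \<nearrow> \<sigma> ! Suc m)"

definition fin_paths_to :: "diagram \<Rightarrow> diagram list set" where
  "fin_paths_to D = {\<sigma>. fin_path \<sigma> \<and> last \<sigma> = D}"

definition Tab :: "(nat \<Rightarrow> diagram) set" where
  "Tab = {\<tau>. \<tau> 0 = {} \<and> (\<forall>n. \<tau> n \<nearrow> \<tau> (Suc n))}"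

definition Cyl :: "diagram list \<Rightarrow> (nat \<Rightarrow> diagram) set" where
  "Cyl \<sigma> = {\<tau> \<in> Tab. \<forall>m < length \<sigma>. \<tau> m = \<sigma> ! m}"

definition truncate :: "nat \<Rightarrow> (nat \<Rightarrow> diagram) \<Rightarrow> diagram list" where
  "truncate n \<tau> = map \<tau> [0..<Suc n]"

text \<open>The set \<^const>\<open>Tab\<close> is the projective limit of the discrete sets of finite paths with
  \<open>n\<close> edges: a path corresponds to the compatible family of its truncations, and the
  topology is the one induced from the product of these sets.\<close>

definition tab_topology :: "(nat \<Rightarrow> diagram) topology" where
  "tab_topology = pullback_topology Tab (\<lambda>\<tau> n. truncate n \<tau>)
     (product_topology (\<lambda>n. discrete_topology {\<sigma>. fin_path \<sigma> \<and> length \<sigma> = Suc n}) UNIV)"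

definition tab_borel :: "(nat \<Rightarrow> diagram) measure" where
  "tab_borel = sigma Tab {U. openin tab_topology U}"

definition multiplicity_function :: "(diagram \<Rightarrow> diagram \<Rightarrow> real) \<Rightarrow> bool" where
  "multiplicity_function \<kappa> \<longleftrightarrow> (\<forall>D E. D \<nearrow> E \<longrightarrow> 0 < \<kappa> D E)"

definition path_weight :: "(diagram \<Rightarrow> diagram \<Rightarrow> real) \<Rightarrow> diagram list \<Rightarrow> real" where
  "path_weight \<kappa> \<sigma> = (\<Prod>m = 1..<length \<sigma>. \<kappa> (\<sigma> ! (m - 1)) (\<sigma> ! m))"

definition dim_kappa :: "(diagram \<Rightarrow> diagram \<Rightarrow> real) \<Rightarrow> diagram \<Rightarrow> real" where
  "dim_kappa \<kappa> D = (\<Sum>\<sigma> \<in> fin_paths_to D. path_weight \<kappa> \<sigma>)"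

definition associated_harmonic ::
  "(diagram \<Rightarrow> diagram \<Rightarrow> real) \<Rightarrow> (nat \<Rightarrow> diagram) measure \<Rightarrow> (diagram \<Rightarrow> real) \<Rightarrow> bool" where
  "associated_harmonic \<kappa> M \<phi> \<longleftrightarrow>
     (\<forall>\<sigma>. fin_path \<sigma> \<longrightarrow> measure M (Cyl \<sigma>) = path_weight \<kappa> \<sigma> * \<phi> (last \<sigma>))"

definition central_measure ::
  "(diagram \<Rightarrow> diagram \<Rightarrow> real) \<Rightarrow> (nat \<Rightarrow> diagram) measure \<Rightarrow> bool" where
  "central_measure \<kappa> M \<longleftrightarrow>
     prob_space M \<and> sets M = sets tab_borel \<and> (\<exists>\<phi>. associated_harmonic \<kappa> M \<phi>)"

definition box_prob :: "(nat \<Rightarrow> diagram) measure \<Rightarrow> nat \<Rightarrow> nat \<Rightarrow> real" where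
  "box_prob M i j = measure M {\<tau> \<in> Tab. (i, j) \<in> (\<Union>n. \<tau> n)}"

definition H' :: "nat \<Rightarrow> nat \<Rightarrow> diagram set" where
  "H' i j = {D. young_diagram D \<and> (i, j) \<notin> D \<and> young_diagram (D \<union> {(i, j)})}"

text \<open>The sum defining \<^const>\<open>dim_kappa\<close> is finite, so the default value 0 of an infinite
  \<^const>\<open>sum\<close> never occurs.\<close>

lemma fin_path_nth:
  assumes "fin_path \<sigma>" "m < length \<sigma>"
  shows "finite (\<sigma> ! m) \<and> card (\<sigma> ! m) = m"
  using assms(2)
proof (induction m)
  case 0
  then show ?case using assms(1) by (simp add: fin_path_def)
next
  case (Suc m)
  then have "\<sigma> ! m \<nearrow> \<sigma> ! Suc m" using assms(1) by (simp add: fin_path_def)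
  with Suc show ?case by (auto simp: young_edge_def)
qed

lemma fin_path_subset_last:
  assumes "fin_path \<sigma>" "m < length \<sigma>"
  shows "\<sigma> ! m \<subseteq> last \<sigma>"
proof -
  have "m + k < length \<sigma> \<Longrightarrow> \<sigma> ! m \<subseteq> \<sigma> ! (m + k)" for k
  proof (induction k)
    case (Suc k)
    then have "\<sigma> ! (m + k) \<nearrow> \<sigma> ! Suc (m + k)" using assms(1) by (simp add: fin_path_def)
    with Suc show ?case by (auto simp: young_edge_def)
  qed simp
  from this[of "length \<sigma> - 1 - m"] assms show ?thesis
    by (auto simp: last_conv_nth fin_path_def)
qed

lemma finite_fin_paths_to: "finite (fin_paths_to D)"
proof (cases "finite D")
  case True
  have "fin_paths_to D \<subseteq> {\<sigma>. set \<sigma> \<subseteq> Pow D \<and> length \<sigma> = Suc (card D)}"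
  proof
    fix \<sigma> assume "\<sigma> \<in> fin_paths_to D"
    then have p: "fin_path \<sigma>" "last \<sigma> = D" by (auto simp: fin_paths_to_def)
    then have "\<sigma> \<noteq> []" by (simp add: fin_path_def)
    then have "length \<sigma> = Suc (card D)"
      using fin_path_nth[OF p(1), of "length \<sigma> - 1"] p(2) by (simp add: last_conv_nth)
    moreover have "set \<sigma> \<subseteq> Pow D"
      using fin_path_subset_last[OF p(1)] p(2) by (force simp: in_set_conv_nth)
    ultimately show "\<sigma> \<in> {\<sigma>. set \<sigma> \<subseteq> Pow D \<and> length \<sigma> = Suc (card D)}" by simp
  qed
  then show ?thesis using True finite_lists_length_eq[of "Pow D"] by (auto intro: finite_subset)
next
  case False
  have "fin_paths_to D = {}"
  proof (rule ccontr)
    assume "fin_paths_to D \<noteq> {}"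
    then obtain \<sigma> where "fin_path \<sigma>" "last \<sigma> = D" by (auto simp: fin_paths_to_def)
    then show False
      using False fin_path_nth[of \<sigma> "length \<sigma> - 1"] by (auto simp: fin_path_def last_conv_nth)
  qed
  then show ?thesis by simp
qed

lemma truncate_fin_path:
  assumes "\<tau> \<in> Tab"
  shows "fin_path (truncate n \<tau>) \<and> length (truncate n \<tau>) = Suc n"
  using assms by (auto simp: Tab_def fin_path_def truncate_def nth_append simp del: upt_Suc)

lemma topspace_tab_topology: "topspace tab_topology = Tab"
  using truncate_fin_path by (auto simp: tab_topology_def topspace_pullback_topology)

lemma space_tab_borel: "space tab_borel = Tab"
  using topspace_tab_topology openin_subset by (subst tab_borel_def, subst space_measure_of) auto

end

theory Submission
  imports Defs
begin

text \<open>A path \<open>\<tau>\<close> that reaches the box \<open>b = (i, j)\<close> adds it in exactly one step, from a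
  diagram \<open>\<mu> \<in> H' i j\<close> to \<open>\<mu> \<union> {b}\<close>; as vertices of level \<open>n\<close> have \<open>n\<close> boxes, this step
  happens at time \<open>card \<mu>\<close>. So the event splits into countably many disjoint pieces indexed by
  \<open>\<mu>\<close>, and the piece of \<open>\<mu>\<close> is the disjoint union, over the finite paths \<open>\<sigma>\<close> to \<open>\<mu>\<close>, of the
  cylinders of \<open>\<sigma> @ [\<mu> \<union> {b}]\<close>.\<close>

text \<open>Sigma-additivity over an arbitrary countable index set, stated with the unordered
  \<open>has_sum\<close> because \<open>H' i j\<close>, usually infinite, has no preferred order.
  The proof enumerates \<open>I\<close> and transports the sequential version back.\<close>

lemma (in finite_measure) has_sum_measure_countable_UN:
  assumes I: "countable I" and A: "A ` I \<subseteq> sets M" and d: "disjoint_family_on A I"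
  shows "((\<lambda>i. measure M (A i)) has_sum measure M (\<Union>i\<in>I. A i)) I"
proof -
  let ?J = "to_nat_on I ` I"
  \<comment> \<open>Numbers that code no index get the empty set, so \<open>B\<close> is a disjoint
    sequence on all naturals and the padding has measure 0.\<close>
  define B where "B n = (if n \<in> ?J then A (from_nat_into I n) else {})" for n
  have BA: "B (to_nat_on I i) = A i" if "i \<in> I" for i
    using that I by (auto simp: B_def)
  have "range B \<subseteq> sets M"
    using A I by (auto simp: B_def)
  moreover have "disjoint_family B"
    using d I unfolding disjoint_family_on_def B_def by (auto simp: disjoint_iff)
  ultimately have s: "(\<lambda>n. measure M (B n)) sums measure M (\<Union>n. B n)"
    by (rule finite_measure_UNION)
  have U: "(\<Union>n. B n) = (\<Union>i\<in>I. A i)"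
    using I by (auto simp: B_def split: if_splits)
  \<comment> \<open>The terms are nonnegative, so convergence of the series is absolute and the
    order of summation is irrelevant.\<close>
  have "((\<lambda>n. measure M (B n)) has_sum measure M (\<Union>i\<in>I. A i)) UNIV"
    using s unfolding U by (intro norm_summable_imp_has_sum) (auto simp: sums_iff)
  then have "((\<lambda>n. measure M (B n)) has_sum measure M (\<Union>i\<in>I. A i)) ?J"
    by (subst has_sum_cong_neutral[where T = UNIV and g = "\<lambda>n. measure M (B n)"])
       (auto simp: B_def)
  then have "((\<lambda>n. measure M (B n)) \<circ> to_nat_on I has_sum measure M (\<Union>i\<in>I. A i)) I"
    using has_sum_reindex[OF inj_on_to_nat_on[OF I]] by blast
  then show ?thesis
    by (rule has_sum_cong[THEN iffD1, rotated]) (simp add: BA)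
qed

lemma Tab_card:
  assumes "\<tau> \<in> Tab"
  shows "finite (\<tau> n) \<and> card (\<tau> n) = n"
proof (induction n)
  case 0
  then show ?case using assms by (simp add: Tab_def)
next
  case (Suc n)
  moreover have "\<tau> n \<nearrow> \<tau> (Suc n)" using assms by (simp add: Tab_def)
  ultimately show ?case by (auto simp: young_edge_def)
qed

lemma fin_paths_to_length:
  assumes "\<sigma> \<in> fin_paths_to D"
  shows "length \<sigma> = Suc (card D)"
proof -
  have p: "fin_path \<sigma>" and l: "last \<sigma> = D" using assms by (simp_all add: fin_paths_to_def)
  then have "\<sigma> \<noteq> []" by (simp add: fin_path_def)
  then show ?thesis
    using fin_path_nth[OF p, of "length \<sigma> - 1"] l by (simp add: last_conv_nth)
qed

text \<open>Cylinders of paths of one length are the fibres of one truncation map. This yields both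
  their openness and their disjointness.\<close>

lemma Cyl_eq_truncate:
  assumes "length \<sigma> = Suc n"
  shows "Cyl \<sigma> = {\<tau> \<in> Tab. truncate n \<tau> = \<sigma>}"
proof -
  have "truncate n \<tau> = \<sigma> \<longleftrightarrow> (\<forall>m < length \<sigma>. \<tau> m = \<sigma> ! m)" for \<tau>
    using assms by (simp add: truncate_def list_eq_iff_nth_eq del: upt_Suc)
  then show ?thesis by (simp add: Cyl_def)
qed

lemma openin_Cyl:
  assumes "fin_path \<sigma>"
  shows "openin tab_topology (Cyl \<sigma>)"
proof -
  obtain n where n: "length \<sigma> = Suc n"
    using assms by (cases "length \<sigma>") (auto simp: fin_path_def)
  let ?X = "\<lambda>n. discrete_topology {\<sigma>. fin_path \<sigma> \<and> length \<sigma> = Suc n}"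
  \<comment> \<open>The singleton of \<open>\<sigma>\<close> is open in the discrete factor
    \<open>n\<close>, and the projection to that factor is continuous.\<close>
  have "openin (product_topology ?X UNIV) {x \<in> topspace (product_topology ?X UNIV). x n \<in> {\<sigma>}}"
    by (rule openin_continuous_map_preimage[OF continuous_map_product_projection])
       (use assms n in auto)
  moreover have "Cyl \<sigma> = (\<lambda>\<tau> n. truncate n \<tau>) -`
      {x \<in> topspace (product_topology ?X UNIV). x n \<in> {\<sigma>}} \<inter> Tab"
    using truncate_fin_path by (auto simp: Cyl_eq_truncate[OF n])
  ultimately show ?thesis
    unfolding tab_topology_def openin_pullback_topology by blast
qed

lemma Cyl_in_sets:
  assumes "fin_path \<sigma>"
  shows "Cyl \<sigma> \<in> sets tab_borel"
proof -
  have "{U. openin tab_topology U} \<subseteq> Pow Tab"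
    using openin_subset topspace_tab_topology by blast
  then show ?thesis
    using openin_Cyl[OF assms] by (auto simp: tab_borel_def)
qed

lemma fin_path_snoc:
  assumes "fin_path \<sigma>" "last \<sigma> \<nearrow> D"
  shows "fin_path (\<sigma> @ [D])"
  unfolding fin_path_def
proof (intro conjI allI impI)
  show "(\<sigma> @ [D]) ! 0 = {}"
    using assms by (auto simp: fin_path_def nth_append)
  fix m assume "Suc m < length (\<sigma> @ [D])"
  then consider "Suc m < length \<sigma>" | "Suc m = length \<sigma>" by fastforce
  then show "(\<sigma> @ [D]) ! m \<nearrow> (\<sigma> @ [D]) ! Suc m"
  proof cases
    case 1
    then show ?thesis using assms by (simp add: fin_path_def nth_append)
  next
    case 2
    then have "last \<sigma> = \<sigma> ! m"
      by (metis diff_Suc_1 last_conv_nth length_0_conv nat.distinct(1))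
    with 2 assms show ?thesis by (simp add: nth_append)
  qed
qed simp

lemma path_weight_snoc:
  assumes "\<sigma> \<noteq> []"
  shows "path_weight \<kappa> (\<sigma> @ [D]) = path_weight \<kappa> \<sigma> * \<kappa> (last \<sigma>) D"
proof -
  have "path_weight \<kappa> (\<sigma> @ [D]) =
      (\<Prod>m = 1..<length \<sigma>. \<kappa> ((\<sigma> @ [D]) ! (m - 1)) ((\<sigma> @ [D]) ! m)) * \<kappa> (last \<sigma>) D"
    using assms by (simp add: path_weight_def prod.atLeastLessThan_Suc Suc_le_eq nth_append last_conv_nth)
  also have "(\<Prod>m = 1..<length \<sigma>. \<kappa> ((\<sigma> @ [D]) ! (m - 1)) ((\<sigma> @ [D]) ! m)) = path_weight \<kappa> \<sigma>"
    unfolding path_weight_def by (intro prod.cong) (auto simp: nth_append)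
  finally show ?thesis .
qed

text \<open>The event that the path uses the edge from \<open>D\<close> to \<open>E\<close>. The
  time can be fixed in advance: a path can visit \<open>D\<close> only at time
  \<open>card D\<close>.\<close>

definition edge_event :: "diagram \<Rightarrow> diagram \<Rightarrow> (nat \<Rightarrow> diagram) set" where
  "edge_event D E = {\<tau> \<in> Tab. \<tau> (card D) = D \<and> \<tau> (Suc (card D)) = E}"

lemma edge_event_eq: "edge_event D E = (\<Union>\<sigma>\<in>fin_paths_to D. Cyl (\<sigma> @ [E]))"
proof (intro equalityI subsetI)
  fix \<tau> assume t: "\<tau> \<in> edge_event D E"
  let ?\<sigma> = "truncate (card D) \<tau>"
  have T: "\<tau> \<in> Tab" using t by (simp add: edge_event_def)
  have "?\<sigma> \<in> fin_paths_to D"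
    using truncate_fin_path[OF T, of "card D"] t
    by (auto simp: fin_paths_to_def truncate_def edge_event_def)
  moreover have "?\<sigma> @ [E] = truncate (Suc (card D)) \<tau>"
    using t by (simp add: truncate_def edge_event_def)
  then have "\<tau> \<in> Cyl (?\<sigma> @ [E])"
    using T by (subst Cyl_eq_truncate[where n = "Suc (card D)"]) (simp_all add: truncate_def)
  ultimately show "\<tau> \<in> (\<Union>\<sigma>\<in>fin_paths_to D. Cyl (\<sigma> @ [E]))" by blast
next
  fix \<tau> assume "\<tau> \<in> (\<Union>\<sigma>\<in>fin_paths_to D. Cyl (\<sigma> @ [E]))"
  then obtain \<sigma> where s: "\<sigma> \<in> fin_paths_to D" and t: "\<tau> \<in> Cyl (\<sigma> @ [E])" by blast
  note l = fin_paths_to_length[OF s]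
  have "\<tau> \<in> Tab" and e: "\<sigma> @ [E] = truncate (Suc (card D)) \<tau>"
    using t l by (auto simp: Cyl_eq_truncate)
  \<comment> \<open>The longer truncation is the shorter one followed by
    \<open>\<tau> (Suc (card D))\<close>; compare last entries and remaining prefixes.\<close>
  moreover have "\<sigma> = truncate (card D) \<tau>" "E = \<tau> (Suc (card D))"
    using e by (simp_all add: truncate_def)
  moreover from this have "D = \<tau> (card D)"
    using s by (simp add: fin_paths_to_def truncate_def)
  ultimately show "\<tau> \<in> edge_event D E" by (simp add: edge_event_def)
qed

lemma edge_event_in_sets:
  assumes "D \<nearrow> E"
  shows "edge_event D E \<in> sets tab_borel"
  unfolding edge_event_eq
  by (intro sets.finite_UN finite_fin_paths_to Cyl_in_sets fin_path_snoc)
     (use assms in \<open>auto simp: fin_paths_to_def\<close>)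

text \<open>By centrality the cylinders of all \<open>\<sigma> @ [E]\<close> share the factors
  \<open>\<kappa> D E\<close> and \<open>\<phi> E\<close>; only the weight of
  \<open>\<sigma>\<close> varies, and these weights add up to
  \<open>dim_kappa \<kappa> D\<close>.\<close>

lemma measure_edge_event:
  assumes c: "central_measure \<kappa> M" and h: "associated_harmonic \<kappa> M \<phi>" and e: "D \<nearrow> E"
  shows "measure M (edge_event D E) = dim_kappa \<kappa> D * \<kappa> D E * \<phi> E"
proof -
  interpret prob_space M using c by (simp add: central_measure_def)
  have p: "fin_path (\<sigma> @ [E])" if "\<sigma> \<in> fin_paths_to D" for \<sigma>
    using that e by (auto simp: fin_paths_to_def intro: fin_path_snoc)
  \<comment> \<open>All lists \<open>\<sigma> @ [E]\<close> have length
    \<open>Suc (Suc (card D))\<close>, so their cylinders are distinct fibres of the same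
    truncation.\<close>
  have "disjoint_family_on (\<lambda>\<sigma>. Cyl (\<sigma> @ [E])) (fin_paths_to D)"
    by (auto simp: disjoint_family_on_def Cyl_eq_truncate[OF trans[OF length_append_singleton
          arg_cong[OF fin_paths_to_length, of _ _ Suc]]])
  moreover have "(\<lambda>\<sigma>. Cyl (\<sigma> @ [E])) ` fin_paths_to D \<subseteq> sets M"
    using c p Cyl_in_sets by (auto simp: central_measure_def)
  ultimately have "measure M (edge_event D E) = (\<Sum>\<sigma>\<in>fin_paths_to D. measure M (Cyl (\<sigma> @ [E])))"
    unfolding edge_event_eq by (intro finite_measure_finite_Union finite_fin_paths_to)
  also have "\<dots> = (\<Sum>\<sigma>\<in>fin_paths_to D. path_weight \<kappa> \<sigma> * (\<kappa> D E * \<phi> E))"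
  proof (rule sum.cong)
    fix \<sigma> assume s: "\<sigma> \<in> fin_paths_to D"
    then have "\<sigma> \<noteq> []" "last \<sigma> = D" by (auto simp: fin_paths_to_def fin_path_def)
    then show "measure M (Cyl (\<sigma> @ [E])) = path_weight \<kappa> \<sigma> * (\<kappa> D E * \<phi> E)"
      using h p[OF s] by (simp add: associated_harmonic_def path_weight_snoc)
  qed simp
  also have "\<dots> = dim_kappa \<kappa> D * \<kappa> D E * \<phi> E"
    by (simp add: dim_kappa_def sum_distrib_right mult.assoc)
  finally show ?thesis .
qed

lemma H'_edge:
  assumes "D \<in> H' i j"
  shows "D \<nearrow> D \<union> {(i, j)}"
  using assms unfolding H'_def young_edge_def by blast

lemma countable_H': "countable (H' i j)"
  by (rule countable_subset[OF _ countable_Collect_finite]) (auto simp: H'_def young_diagram_def)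

lemma Tab_mono:
  assumes "\<tau> \<in> Tab" "m \<le> n"
  shows "\<tau> m \<subseteq> \<tau> n"
proof (rule lift_Suc_mono_le[OF _ assms(2)])
  fix k
  have "\<tau> k \<nearrow> \<tau> (Suc k)" using assms(1) by (simp add: Tab_def)
  then show "\<tau> k \<subseteq> \<tau> (Suc k)" unfolding young_edge_def by blast
qed

lemma box_event_eq:
  "{\<tau> \<in> Tab. (i, j) \<in> (\<Union>n. \<tau> n)} = (\<Union>D\<in>H' i j. edge_event D (D \<union> {(i, j)}))"
proof (intro equalityI subsetI)
  fix \<tau> assume "\<tau> \<in> {\<tau> \<in> Tab. (i, j) \<in> (\<Union>n. \<tau> n)}"
  then obtain k where T: "\<tau> \<in> Tab" and k: "(i, j) \<in> \<tau> k" by auto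
  have "(i, j) \<notin> \<tau> 0" using T by (simp add: Tab_def)
  \<comment> \<open>\<open>Suc n\<close> is the first time at which the box is present; it is
    positive since the path starts at the empty diagram.\<close>
  with k obtain n where n: "(i, j) \<notin> \<tau> n" "(i, j) \<in> \<tau> (Suc n)"
    using ex_least_nat_less[of "\<lambda>n. (i, j) \<in> \<tau> n" k] by blast
  have e: "\<tau> n \<nearrow> \<tau> (Suc n)" using T by (simp add: Tab_def)
  with n have E: "\<tau> (Suc n) = \<tau> n \<union> {(i, j)}" by (auto simp: young_edge_def)
  with e n have "\<tau> n \<in> H' i j" by (auto simp: H'_def young_edge_def)
  \<comment> \<open>The time built into \<open>edge_event\<close> is the right one, as
    \<open>card (\<tau> n) = n\<close>.\<close>
  moreover have "\<tau> \<in> edge_event (\<tau> n) (\<tau> n \<union> {(i, j)})"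
    using T E Tab_card[OF T, of n] by (simp add: edge_event_def)
  ultimately show "\<tau> \<in> (\<Union>D\<in>H' i j. edge_event D (D \<union> {(i, j)}))" by blast
qed (auto simp: edge_event_def)

text \<open>Paths only grow, so a box that has entered stays and cannot be added a second
  time.\<close>

lemma disjoint_edge_events:
  "disjoint_family_on (\<lambda>D. edge_event D (D \<union> {b})) {D. b \<notin> D}"
proof -
  \<comment> \<open>Otherwise \<open>b\<close>, present from time \<open>Suc (card D)\<close> on,
    would lie in \<open>\<tau> (card E) = E\<close>.\<close>
  have le: "card E \<le> card D"
    if "b \<notin> E" "\<tau> \<in> edge_event D (D \<union> {b})" "\<tau> \<in> edge_event E (E \<union> {b})" for D E \<tau>
  proof (rule ccontr)
    assume "\<not> card E \<le> card D"
    then have "\<tau> (Suc (card D)) \<subseteq> \<tau> (card E)"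
      using that by (intro Tab_mono) (auto simp: edge_event_def)
    with that show False by (auto simp: edge_event_def)
  qed
  have "D = E"
    if "b \<notin> D" "b \<notin> E" "\<tau> \<in> edge_event D (D \<union> {b})" "\<tau> \<in> edge_event E (E \<union> {b})" for D E \<tau>
  proof -
    \<comment> \<open>With the two times equal, \<open>D\<close> and \<open>E\<close> are the same
      vertex of \<open>\<tau>\<close>.\<close>
    have "card D = card E" using le[of E \<tau> D] le[of D \<tau> E] that by simp
    with that show ?thesis by (metis (mono_tags, lifting) edge_event_def mem_Collect_eq)
  qed
  then show ?thesis by (fastforce simp: disjoint_family_on_def)
qed

theorem theorem1p8p3:
  fixes \<kappa> :: "diagram \<Rightarrow> diagram \<Rightarrow> real"
    and M :: "(nat \<Rightarrow> diagram) measure"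
    and \<phi> :: "diagram \<Rightarrow> real"
    and i j :: nat
  assumes "multiplicity_function \<kappa>"
    and "central_measure \<kappa> M"
    and "associated_harmonic \<kappa> M \<phi>"
    and "i \<ge> 1" and "j \<ge> 1"
  shows "((\<lambda>\<mu>. dim_kappa \<kappa> \<mu> * \<kappa> \<mu> (\<mu> \<union> {(i, j)}) * \<phi> (\<mu> \<union> {(i, j)}))
           has_sum box_prob M i j) (H' i j)"
proof -
  interpret prob_space M using assms(2) by (simp add: central_measure_def)
  let ?A = "\<lambda>D. edge_event D (D \<union> {(i, j)})"
  have "((\<lambda>D. measure M (?A D)) has_sum measure M (\<Union>D\<in>H' i j. ?A D)) (H' i j)"
  proof (rule has_sum_measure_countable_UN[OF countable_H'])
    show "?A ` H' i j \<subseteq> sets M"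
      using assms(2) edge_event_in_sets[OF H'_edge] by (auto simp: central_measure_def)
    show "disjoint_family_on ?A (H' i j)"
      by (rule disjoint_family_on_mono[OF _ disjoint_edge_events]) (auto simp: H'_def)
  qed
  then have "((\<lambda>D. measure M (?A D)) has_sum box_prob M i j) (H' i j)"
    by (simp only: box_prob_def box_event_eq)
  then show ?thesis
    by (rule has_sum_cong[THEN iffD1, rotated])
       (rule measure_edge_event[OF assms(2,3) H'_edge])
qed

end
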